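(* Let $G_1$ and $G_2$ be two global types and let $\mathsf{com}$ be a communication model such that $\mathrm{Exec}(\mathsf{com})\supseteq \mathrm{Exec}(\mathsf{synch})$. Then $G_1$ is a subtype of $G_2$ in $\mathsf{com}$ if and only if $\mathcal L_\exists(G_1)\subseteq \mathcal L_\exists(G_2)$.
   Context: Fix a finite set $P$ of processes and a finite set $\mathbb M$ of messages. Actions are send actions $p!q(m)$ (executed by $p$: $p$ sends $m$ to $q$) and receive actions $p?q(m)$ (executed by $q$: $q$ receives $m$ from $p$); $\mathrm{Act}$ is the set of actions and $\mathrm{Act}_p$ the set of actions executed by $p$. An event of a word $w\in \mathrm{Act}^*$ is a position of $w$. An execution is a pair $e=(w,\mathrm{src})$ with $w\in \mathrm{Act}^*$ and $\mathrm{src}$ an injective function from the receive events of $w$ to the send events of $w$ such that a receive event $r$ labelled $p?q(m)$ has $\mathrm{src}(r)<r$ and $\mathrm{src}(r)$ labelled $p!q(m)$. A communication model $\mathsf{com}$ is a set $\mathrm{Exec}(\mathsf{com})$ of executions. $\mathrm{Exec}(\mathsf{synch})$ is the set of executions in which, for every send event $s$, $s+1$ is a receive event with $\mathrm{src}(s+1)=s$. An MSC is a pair $M=((w_p)_{p\in P},\mathrm{src})$ with $w_p\in \mathrm{Act}_p^*$; its events are pairs ($p$, position in $w_p$), and $\mathrm{src}$ is an injective map from receive events to send events such that a receive event labelled $p?q(m)$ is mapped to a send event labelled $p!q(m)$. For an execution $e=(w,\mathrm{src})$, $\mathrm{msc}(e)$ is the MSC whose $w_p$ is the subsequence of actions of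 $p$ in $w$, with $\mathrm{src}$ transported. The linearisations of $M$ are the executions $e$ with $\mathrm{msc}(e)=M$; $\mathrm{Lin}_{\mathsf{com}}(M)$ is the set of those lying in $\mathrm{Exec}(\mathsf{com})$. An arrow is a triple $p\to q{:}m$ with $p\neq q$ in $P$, $m\in\mathbb M$; $\mathrm{Arr}$ is the finite set of arrows. A global type is a deterministic finite automaton over the alphabet $\mathrm{Arr}$; $L(G)\subseteq \mathrm{Arr}^*$ is its accepted language. For $w\in \mathrm{Arr}^*$, $\mathrm{msc}(w)$ is the MSC of the synchronous execution obtained by replacing each arrow $p\to q{:}m$ by $p!q(m)\cdot p?q(m)$. $\mathcal L_\exists(G)=\{\mathrm{msc}(w)\mid w\in L(G)\}$. The semantics of $G$ in $\mathsf{com}$ is $\mathrm{Exec}(G,\mathsf{com})=\bigcup\{\mathrm{Lin}_{\mathsf{com}}(M)\mid M\in\mathcal L_\exists(G)\}$. $G_1$ is a subtype of $G_2$ in $\mathsf{com}$ if $\mathrm{Exec}(G_1,\mathsf{com})\subseteq \mathrm{Exec}(G_2,\mathsf{com})$. *)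

theory Defs
  imports Main
begin

text \<open>The finite sets of processes and of messages are the types \<open>'p\<close> and \<open>'m\<close>; the
  theorem constrains them to the class \<^class>\<open>finite\<close>.\<close>

text \<open>\<open>Send p q m\<close> is $p!q(m)$, executed by \<open>p\<close>; \<open>Recv p q m\<close> is $p?q(m)$, executed by
  \<open>q\<close>. In both cases \<open>p\<close> is the sender and \<open>q\<close> the receiver.\<close>

datatype ('p, 'm) action = Send 'p 'p 'm | Recv 'p 'p 'm

fun executor :: "('p, 'm) action \<Rightarrow> 'p" where
  "executor (Send p q m) = p"
| "executor (Recv p q m) = q"

fun matching_send :: "('p, 'm) action \<Rightarrow> ('p, 'm) action \<Rightarrow> bool" where
  "matching_send (Recv p q m) a \<longleftrightarrow> a = Send p q m"
| "matching_send (Send p q m) a \<longleftrightarrow> False"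

definition is_send :: "('p, 'm) action \<Rightarrow> bool" where
  "is_send a \<longleftrightarrow> (\<exists>p q m. a = Send p q m)"

definition is_recv :: "('p, 'm) action \<Rightarrow> bool" where
  "is_recv a \<longleftrightarrow> (\<exists>p q m. a = Recv p q m)"

section \<open>Executions and communication models\<close>

text \<open>Events of a word are its positions, counted from 0.\<close>

definition send_events :: "('p, 'm) action list \<Rightarrow> nat set" where
  "send_events w = {i. i < length w \<and> is_send (w ! i)}"

definition recv_events :: "('p, 'm) action list \<Rightarrow> nat set" where
  "recv_events w = {i. i < length w \<and> is_recv (w ! i)}"

text \<open>The function \<open>src\<close> is a partial map that is undefined outside the receive events, so that
  equality of maps is equality of functions on the receive events.\<close>

type_synonym ('p, 'm) execution = "('p, 'm) action list \<times> (nat \<rightharpoonup> nat)"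

definition executions :: "('p, 'm) execution set" where
  "executions = {(w, src).
     dom src = recv_events w \<and> ran src \<subseteq> send_events w \<and> inj_on src (dom src) \<and>
     (\<forall>r s. src r = Some s \<longrightarrow> s < r \<and> matching_send (w ! r) (w ! s))}"

definition communication_model :: "('p, 'm) execution set \<Rightarrow> bool" where
  "communication_model com \<longleftrightarrow> com \<subseteq> executions"

definition synch :: "('p, 'm) execution set" where
  "synch = {(w, src) \<in> executions.
     \<forall>s \<in> send_events w. Suc s \<in> recv_events w \<and> src (Suc s) = Some s}"

section \<open>Message sequence charts\<close>

type_synonym 'p msc_event = "'p \<times> nat"

type_synonym ('p, 'm) msc = "('p \<Rightarrow> ('p, 'm) action list) \<times> ('p msc_event \<rightharpoonup> 'p msc_event)"

definition msc_send_events :: "('p \<Rightarrow> ('p, 'm) action list) \<Rightarrow> 'p msc_event set" where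
  "msc_send_events W = {(p, i). i \<in> send_events (W p)}"

definition msc_recv_events :: "('p \<Rightarrow> ('p, 'm) action list) \<Rightarrow> 'p msc_event set" where
  "msc_recv_events W = {(p, i). i \<in> recv_events (W p)}"

definition mscs :: "('p, 'm) msc set" where
  "mscs = {(W, src).
     (\<forall>p. \<forall>a \<in> set (W p). executor a = p) \<and>
     dom src = msc_recv_events W \<and> ran src \<subseteq> msc_send_events W \<and> inj_on src (dom src) \<and>
     (\<forall>p i q j. src (p, i) = Some (q, j) \<longrightarrow> matching_send (W p ! i) (W q ! j))}"

definition proj :: "('p, 'm) action list \<Rightarrow> 'p \<Rightarrow> ('p, 'm) action list" where
  "proj w p = filter (\<lambda>a. executor a = p) w"

text \<open>The MSC event that corresponds to position \<open>i\<close> of \<open>w\<close>.\<close>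

definition event_of :: "('p, 'm) action list \<Rightarrow> nat \<Rightarrow> 'p msc_event" where
  "event_of w i = (executor (w ! i), length (proj (take i w) (executor (w ! i))))"

fun msc_of :: "('p, 'm) execution \<Rightarrow> ('p, 'm) msc" where
  "msc_of (w, src) =
    (proj w,
     \<lambda>x. if x \<in> event_of w ` {..<length w}
         then map_option (event_of w) (src (the_inv_into {..<length w} (event_of w) x))
         else None)"

definition linearisations :: "('p, 'm) msc \<Rightarrow> ('p, 'm) execution set" where
  "linearisations M = {e \<in> executions. msc_of e = M}"

definition lin_in :: "('p, 'm) execution set \<Rightarrow> ('p, 'm) msc \<Rightarrow> ('p, 'm) execution set" where
  "lin_in com M = linearisations M \<inter> com"

section \<open>Global types\<close>

text \<open>The triple \<open>(p, q, m)\<close> is the arrow $p \to q{:}m$.\<close>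

type_synonym ('p, 'm) arrow = "'p \<times> 'p \<times> 'm"

definition arrows :: "('p, 'm) arrow set" where
  "arrows = {(p, q, m). p \<noteq> q}"

text \<open>Transition functions may be partial; a complete automaton is a special case.\<close>

record ('s, 'p, 'm) automaton =
  states :: "'s set"
  init :: 's
  final :: "'s set"
  delta :: "'s \<Rightarrow> ('p, 'm) arrow \<Rightarrow> 's option"

definition global_type :: "('s, 'p, 'm) automaton \<Rightarrow> bool" where
  "global_type G \<longleftrightarrow>
     finite (states G) \<and> init G \<in> states G \<and> final G \<subseteq> states G \<and>
     (\<forall>s a s'. delta G s a = Some s' \<longrightarrow> s \<in> states G \<and> a \<in> arrows \<and> s' \<in> states G)"

fun run :: "('s, 'p, 'm) automaton \<Rightarrow> 's \<Rightarrow> ('p, 'm) arrow list \<Rightarrow> 's option" where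
  "run G s [] = Some s"
| "run G s (a # w) = Option.bind (delta G s a) (\<lambda>s'. run G s' w)"

definition lang :: "('s, 'p, 'm) automaton \<Rightarrow> ('p, 'm) arrow list set" where
  "lang G = {w. \<exists>f \<in> final G. run G (init G) w = Some f}"

text \<open>Replacing each arrow by its send followed by its receive places the sends at the even
  positions and the receives at the odd positions.\<close>

definition sync_exec :: "('p, 'm) arrow list \<Rightarrow> ('p, 'm) execution" where
  "sync_exec w =
    (concat (map (\<lambda>(p, q, m). [Send p q m, Recv p q m]) w),
     \<lambda>i. if i < 2 * length w \<and> odd i then Some (i - 1) else None)"

definition exist_lang :: "('s, 'p, 'm) automaton \<Rightarrow> ('p, 'm) msc set" where
  "exist_lang G = (\<lambda>w. msc_of (sync_exec w)) ` lang G"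

definition Exec :: "('s, 'p, 'm) automaton \<Rightarrow> ('p, 'm) execution set \<Rightarrow> ('p, 'm) execution set"
  where "Exec G com = (\<Union>M \<in> exist_lang G. lin_in com M)"

definition subtype ::
  "('s, 'p, 'm) automaton \<Rightarrow> ('t, 'p, 'm) automaton \<Rightarrow> ('p, 'm) execution set \<Rightarrow> bool" where
  "subtype G1 G2 com \<longleftrightarrow> Exec G1 com \<subseteq> Exec G2 com"

section \<open>Well-definedness\<close>

text \<open>\<open>event_of w\<close> is a bijection between the positions of \<open>w\<close> and the events of \<open>proj w\<close>,
  \<open>msc_of\<close> yields MSCs, and \<open>sync_exec\<close> yields synchronous executions.\<close>

lemma proj_nth_event_of:
  assumes "i < length w" and "event_of w i = (p, k)"
  shows "k < length (proj w p) \<and> proj w p ! k = w ! i"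
proof -
  have p: "executor (w ! i) = p" and k: "k = length (proj (take i w) p)"
    using assms(2) by (auto simp: event_of_def)
  have "w = take i w @ w ! i # drop (Suc i) w" using assms(1) by (rule id_take_nth_drop)
  then have "proj w p = proj (take i w @ w ! i # drop (Suc i) w) p" by simp
  also have "\<dots> = proj (take i w) p @ w ! i # proj (drop (Suc i) w) p"
    using p by (simp add: proj_def)
  finally show ?thesis using k by simp
qed

lemma event_of_less:
  assumes "i < j" and "j < length w" and "executor (w ! i) = executor (w ! j)"
  shows "snd (event_of w i) < snd (event_of w j)"
proof -
  have "i < length (take j w)" "event_of (take j w) i = event_of w i"
    using assms by (auto simp: event_of_def min_def)
  from proj_nth_event_of[OF this(1)] this(2) show ?thesis
    using assms(3) by (auto simp: event_of_def)
qed

lemma inj_event_of: "inj_on (event_of w) {..<length w}"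
proof (rule inj_onI)
  fix i j assume *: "i \<in> {..<length w}" "j \<in> {..<length w}" "event_of w i = event_of w j"
  then have "executor (w ! i) = executor (w ! j)" by (simp add: event_of_def)
  then show "i = j" using event_of_less[of i j w] event_of_less[of j i w] *
    by (cases i j rule: linorder_cases) auto
qed

lemma event_of_surj:
  "k < length (proj w p) \<Longrightarrow> \<exists>i < length w. event_of w i = (p, k)"
proof (induction w rule: rev_induct)
  case Nil then show ?case by (simp add: proj_def)
next
  case (snoc a w)
  show ?case
  proof (cases "k < length (proj w p)")
    case True
    then obtain i where "i < length w" "event_of w i = (p, k)" using snoc.IH by blast
    then show ?thesis by (intro exI[of _ i]) (auto simp: event_of_def nth_append)
  next
    case False
    then have "executor a = p" "k = length (proj w p)"
      using snoc.prems by (auto simp: proj_def split: if_splits)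
    then show ?thesis by (intro exI[of _ "length w"]) (auto simp: event_of_def)
  qed
qed

lemma msc_of_src:
  assumes "i < length w"
  shows "snd (msc_of (w, src)) (event_of w i) = map_option (event_of w) (src i)"
  using assms by (simp add: the_inv_into_f_f[OF inj_event_of])

lemma msc_of_in_mscs:
  assumes "e \<in> executions"
  shows "msc_of e \<in> mscs"
proof -
  obtain w src where e: "e = (w, src)" by force
  define S where "S = snd (msc_of e)"
  have dom: "dom src = recv_events w" and ran: "ran src \<subseteq> send_events w"
    and inj: "inj_on src (dom src)"
    and mat: "\<And>r s. src r = Some s \<Longrightarrow> s < r \<and> matching_send (w ! r) (w ! s)"
    using assms by (auto simp: executions_def e)
  have msc: "msc_of e = (proj w, S)" by (simp add: S_def e)
  have lt: "r < length w \<and> s < length w" if "src r = Some s" for r s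
    using dom ran that by (fastforce simp: recv_events_def send_events_def ran_def)
  have S1: "\<exists>r s. src r = Some s \<and> r < length w \<and> s < length w \<and> event_of w r = x \<and> event_of w s = y"
    if "S x = Some y" for x y
  proof -
    from that have "x \<in> event_of w ` {..<length w}" by (auto simp: S_def e split: if_splits)
    then obtain r where r: "r < length w" "x = event_of w r" by auto
    then have "map_option (event_of w) (src r) = Some y" 
      using that msc_of_src[of r w src] by (simp add: S_def e del: msc_of.simps)
    then obtain s where "src r = Some s" "y = event_of w s" by auto
    then show ?thesis using r lt by blast
  qed
  have S2: "S (event_of w r) = Some (event_of w s)" if "src r = Some s" for r s
    using msc_of_src[of r w src] lt[OF that] that by (simp add: S_def e del: msc_of.simps)
  have recv: "event_of w i \<in> msc_recv_events (proj w) \<longleftrightarrow> i \<in> recv_events w"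
    and send: "event_of w i \<in> msc_send_events (proj w) \<longleftrightarrow> i \<in> send_events w"
    if "i < length w" for i
    using proj_nth_event_of[OF that, of "fst (event_of w i)" "snd (event_of w i)"] that
    by (auto simp: msc_recv_events_def msc_send_events_def recv_events_def send_events_def
        split: prod.splits)
  have "dom S = msc_recv_events (proj w)"
  proof (intro equalityI subsetI)
    fix x assume "x \<in> dom S"
    then show "x \<in> msc_recv_events (proj w)" using S1 recv dom by (metis domD domI)
  next
    fix x assume x: "x \<in> msc_recv_events (proj w)"
    then obtain i where "i < length w" "event_of w i = x"
      using event_of_surj[of "snd x" w "fst x"]
      by (auto simp: msc_recv_events_def recv_events_def)
    then show "x \<in> dom S" using x recv dom S2 by (metis domD domI)
  qed
  moreover have "ran S \<subseteq> msc_send_events (proj w)"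
  proof
    fix y assume "y \<in> ran S"
    then obtain x where "S x = Some y" by (auto simp: ran_def)
    from S1[OF this] show "y \<in> msc_send_events (proj w)" using send ran by (auto simp: ran_def)
  qed
  moreover have "inj_on S (dom S)"
  proof (rule inj_onI)
    fix x x' assume "x \<in> dom S" "x' \<in> dom S" and eq: "S x = S x'"
    then obtain y where "S x = Some y" "S x' = Some y" by auto
    from S1[OF this(1)] S1[OF this(2)] obtain r s r' s' where *:
      "src r = Some s" "s < length w" "event_of w r = x" "event_of w s = y"
      "src r' = Some s'" "s' < length w" "event_of w r' = x'" "event_of w s' = y" by blast
    then have "s = s'" using inj_event_of[of w] by (auto dest!: inj_onD)
    then show "x = x'" using * inj by (metis domI inj_onD)
  qed
  moreover have "matching_send (proj w p ! i) (proj w q ! j)" if S: "S (p, i) = Some (q, j)" for p i q j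
    using S1[OF S] mat proj_nth_event_of by metis
  ultimately show ?thesis by (auto simp: msc mscs_def proj_def)
qed

lemma sync_exec_nth:
  assumes "i < length w" and "w ! i = (p, q, m)"
  shows "fst (sync_exec w) ! (2 * i) = Send p q m"
    and "fst (sync_exec w) ! Suc (2 * i) = Recv p q m"
proof -
  have "fst (sync_exec w) ! (2 * i) = Send p q m \<and> fst (sync_exec w) ! Suc (2 * i) = Recv p q m"
    using assms
  proof (induction w arbitrary: i)
    case (Cons a w)
    then show ?case by (cases i; cases a) (auto simp: sync_exec_def)
  qed simp
  then show "fst (sync_exec w) ! (2 * i) = Send p q m"
    and "fst (sync_exec w) ! Suc (2 * i) = Recv p q m" by auto
qed

lemma length_sync_exec: "length (fst (sync_exec w)) = 2 * length w"
  by (induction w) (auto simp: sync_exec_def split: prod.splits)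

lemma sync_exec_in_synch: "sync_exec w \<in> synch"
proof -
  define v where "v = fst (sync_exec w)"
  define src where "src = snd (sync_exec w)"
  have len: "length v = 2 * length w" by (simp add: v_def length_sync_exec)
  have ev: "\<exists>p q m. v ! (2 * i) = Send p q m \<and> v ! Suc (2 * i) = Recv p q m" if "i < length w" for i
    using sync_exec_nth[OF that] by (cases "w ! i") (auto simp: v_def)
  have src: "src i = (if i < 2 * length w \<and> odd i then Some (i - 1) else None)" for i
    by (simp add: src_def sync_exec_def)
  have send: "send_events v = {i. i < 2 * length w \<and> even i}"
    and recv: "recv_events v = {i. i < 2 * length w \<and> odd i}"
  proof -
    have "is_send (v ! i) \<longleftrightarrow> even i" "is_recv (v ! i) \<longleftrightarrow> odd i" if "i < 2 * length w" for i
    proof -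
      have "i div 2 < length w" using that by auto
      from ev[OF this] show "is_send (v ! i) \<longleftrightarrow> even i" "is_recv (v ! i) \<longleftrightarrow> odd i"
        by (cases "even i"; auto simp: is_send_def is_recv_def elim!: oddE)+
    qed
    then show "send_events v = {i. i < 2 * length w \<and> even i}"
      and "recv_events v = {i. i < 2 * length w \<and> odd i}"
      by (auto simp: send_events_def recv_events_def len)
  qed
  have "matching_send (v ! r) (v ! s) \<and> s < r" if "src r = Some s" for r s
  proof -
    from that obtain i where "r = Suc (2 * i)" "s = 2 * i" "i < length w"
      by (auto simp: src split: if_splits elim!: oddE)
    with ev[of i] show ?thesis by auto
  qed
  moreover have "inj_on src (dom src)"
    by (rule inj_onI) (auto simp: src dom_def elim!: oddE split: if_splits)
  moreover have "dom src = recv_events v" by (auto simp: recv src dom_def)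
  moreover have "ran src \<subseteq> send_events v" by (auto simp: send src ran_def split: if_splits)
  ultimately have "(v, src) \<in> executions" by (auto simp: executions_def)
  moreover have "Suc s \<in> recv_events v \<and> src (Suc s) = Some s" if "s \<in> send_events v" for s
    using that by (auto simp: send recv src elim!: evenE)
  ultimately show ?thesis by (simp add: synch_def v_def src_def case_prod_beta)
qed

end

theory Submission
  imports Defs
begin

text \<open>An execution has only one MSC, so the sets \<open>lin_in com M\<close> are pairwise
  disjoint. For \<open>M\<close> in \<open>exist_lang G1\<close> this set is nonempty: by
  \<open>sync_exec_in_lin_in\<close> it contains the synchronous execution that defines
  \<open>M\<close>. Hence \<open>Exec G1 com\<close> determines which MSCs occur. The converse is
  monotonicity of the union.\<close>

lemma sync_exec_in_lin_in:
  assumes "synch \<subseteq> com"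
  shows "sync_exec w \<in> lin_in com (msc_of (sync_exec w))"
  using assms sync_exec_in_synch[of w]
  by (auto simp: lin_in_def linearisations_def synch_def)

theorem theorem4p10:
  fixes G1 :: "('s, 'p :: finite, 'm :: finite) automaton"
    and G2 :: "('t, 'p, 'm) automaton"
    and com :: "('p, 'm) execution set"
  assumes "global_type G1"
    and "global_type G2"
    and "communication_model com"
    and "synch \<subseteq> com"
  shows "subtype G1 G2 com \<longleftrightarrow> exist_lang G1 \<subseteq> exist_lang G2"
proof
  assume sub: "subtype G1 G2 com"
  show "exist_lang G1 \<subseteq> exist_lang G2"
  proof
    fix M assume M: "M \<in> exist_lang G1"
    then obtain w where w: "M = msc_of (sync_exec w)"
      by (auto simp: exist_lang_def)
    then have "sync_exec w \<in> Exec G1 com"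
      using M sync_exec_in_lin_in[OF assms(4)] by (auto simp: Exec_def)
    then obtain M' where "M' \<in> exist_lang G2" "sync_exec w \<in> lin_in com M'"
      using sub by (auto simp: subtype_def Exec_def)
    \<comment> \<open>Both \<open>M\<close> and \<open>M'\<close> are the MSC of
      \<open>sync_exec w\<close>, hence \<open>M' = M\<close>.\<close>
    then show "M \<in> exist_lang G2"
      by (simp add: w lin_in_def linearisations_def)
  qed
next
  assume "exist_lang G1 \<subseteq> exist_lang G2"
  then show "subtype G1 G2 com"
    by (auto simp: subtype_def Exec_def)
qed

end
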